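(* Let $n\ge 2$, let $\Delta:=(a_1,a_2,\ldots,a_n)$, where $a_1\geq a_2\geq\cdots\geq a_n\geq 0$ are real, let $\rho\geq 0$ and let $(\lambda_2,\lambda_3,\ldots,\lambda_n)$ be a self-conjugate list of complex numbers with nonpositive real parts. Put $\sigma:=(\rho,\lambda_2,\lambda_3,\ldots,\lambda_n)$. Then $\sigma$ is the spectrum of a nonnegative $n\times n$ matrix with diagonal elements $\Delta$ if and only if $$s_1(\Delta)=s_1(\sigma)\qquad\text{and}\qquad s_2(\Delta)\leq s_2(\sigma).$$ Furthermore, if these two conditions are satisfied, then $\sigma$ is the spectrum of a nonnegative matrix of the form $$A=\begin{bmatrix} a_1 & 1 & & & \\ & a_2 & 1 & & \\ & & \ddots & \ddots & \\ & & & a_{n-1} & 1\\ b_n & b_{n-1} & \cdots & b_2 & a_n\end{bmatrix}$$ (all entries not shown being zero), with diagonal entries $a_1,\dots,a_n$ in this order.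
   Context: A matrix is nonnegative if all of its entries are real and $\geq 0$. The spectrum of an $n\times n$ matrix is the list of its eigenvalues counted with algebraic multiplicity (order immaterial). A list of complex numbers is self-conjugate if the list of complex conjugates equals it up to reordering. A matrix has diagonal elements $\Delta$ if the list of its diagonal entries is $\Delta$ (up to order). For a list $\tau=(x_1,\ldots,x_n)$ of complex numbers and a positive integer $k$, $s_k(\tau):=\sum_{i=1}^n x_i^k$. In the matrix $A$, for $i=1,\dots,n-1$ the $i$-th row has $a_i$ in column $i$, $1$ in column $i+1$ and zeros elsewhere; the last row is $(b_n,b_{n-1},\ldots,b_2,a_n)$ (for $n=2$, $A=\begin{bmatrix}a_1&1\\ b_2&a_2\end{bmatrix}$). *)

theory Defs
  imports
    "Jordan_Normal_Form.Char_Poly"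
    "HOL-Computational_Algebra.Computational_Algebra"
begin

text \<open>The spectrum of a square complex matrix as a multiset: the multiplicity of an eigenvalue is
  its multiplicity as a root of the characteristic polynomial. For a real matrix it is applied to
  the complexification \<open>map_mat complex_of_real A\<close>.\<close>

definition spectrum_mset :: "complex mat \<Rightarrow> complex multiset" where
  "spectrum_mset A = proots (char_poly A)"

definition nonneg_mat :: "real mat \<Rightarrow> bool" where
  "nonneg_mat A \<longleftrightarrow> (\<forall>i<dim_row A. \<forall>j<dim_col A. 0 \<le> A $$ (i, j))"

definition self_conjugate :: "complex list \<Rightarrow> bool" where
  "self_conjugate xs \<longleftrightarrow> mset (map cnj xs) = mset xs"

definition power_sum :: "nat \<Rightarrow> 'a :: comm_semiring_1 list \<Rightarrow> 'a" where
  "power_sum k xs = (\<Sum>x\<leftarrow>xs. x ^ k)"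

text \<open>Rows, columns and the list \<open>\<Delta> = (a\<^sub>1, \<dots>, a\<^sub>n)\<close> are indexed from 0, whereas
  the last-row parameters \<open>b 2, \<dots>, b n\<close> keep their usual 1-based names (other values of
  \<open>b\<close> do not occur): the last row is \<open>b n, b (n - 1), \<dots>, b 2, a\<^sub>n\<close>.\<close>

definition companion_form :: "real list \<Rightarrow> (nat \<Rightarrow> real) \<Rightarrow> real mat" where
  "companion_form \<Delta> b = (let n = length \<Delta> in
     mat n n (\<lambda>(i, j).
       if j = i then \<Delta> ! i
       else if j = i + 1 then 1
       else if i = n - 1 then b (n - j)
       else 0))"

text \<open>Power sums of a self-conjugate list are real, so comparing one with a real number through
  its real part loses nothing.\<close>

lemma power_sum_self_conjugate_Reals:
  assumes "self_conjugate xs"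
  shows "power_sum k xs \<in> \<real>"
proof -
  have "cnj (power_sum k xs) = power_sum k (map cnj xs)"
    unfolding power_sum_def by (induction xs) auto
  also have "\<dots> = sum_mset (image_mset (\<lambda>x. x ^ k) (mset (map cnj xs)))"
    unfolding power_sum_def by (metis mset_map sum_mset_sum_list)
  also have "\<dots> = sum_mset (image_mset (\<lambda>x. x ^ k) (mset xs))"
    using assms unfolding self_conjugate_def by simp
  also have "\<dots> = power_sum k xs"
    unfolding power_sum_def by (metis mset_map sum_mset_sum_list)
  finally show ?thesis by (simp add: Reals_cnj_iff)
qed

lemma self_conjugate_Cons_of_real:
  "self_conjugate (complex_of_real r # xs) \<longleftrightarrow> self_conjugate xs"
  by (simp add: self_conjugate_def)

end

theory Submission
  imports Defs "Jordan_Normal_Form.Schur_Decomposition"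
begin

text \<open>Necessity of the two conditions is a matter of traces: the traces of \<open>A\<close> and \<open>A\<^sup>2\<close> are the first
  two power sums of the spectrum, and for nonnegative \<open>A\<close> the trace of \<open>A\<^sup>2\<close> is at least the sum of the
  squares of the diagonal entries.

  For sufficiency let \<open>f(x) = (x - \<rho>) \<Prod>(x - \<lambda>\<^sub>i)\<close>. Expanding the characteristic polynomial of the
  companion form along the first column is the same as dividing synthetically by \<open>x - a\<^sub>1\<close>,
  \<open>x - a\<^sub>2\<close>, \<open>\<dots>\<close>. The companion form with characteristic polynomial \<open>f\<close> therefore exists as soon as
  \<open>f[a\<^sub>1, \<dots>, a\<^sub>n] = 0\<close>, which is the trace condition, and its last row then consists of the negated
  divided differences \<open>f[a\<^sub>1, \<dots>, a\<^sub>j]\<close> for \<open>j < n\<close> (\<open>companion_form_realizes\<close>). It remains to show that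
  these divided differences are not positive (\<open>divided_difference_nonpos\<close>).

  Since \<open>f[a\<^sub>1, \<dots>, a\<^sub>j]\<close> does not depend on the remaining \<open>a\<^sub>i\<close>, those may be replaced by their mean
  \<open>a\<close>: the first power sum stays the same and the second does not grow, so both conditions survive.
  The conditions and the divided differences are invariant under translation. With \<open>a\<close> as the
  origin, and with \<open>d\<^sub>i = a\<^sub>i - a \<ge> 0\<close>, \<open>\<rho>' = \<rho> - a\<close> and \<open>\<lambda>\<^sub>i' = \<lambda>\<^sub>i - a\<close>, the divided difference is a
  coefficient, of positive index, of the power series \<open>(1 - \<rho>' t) Q(t)\<close>, where
  \<open>Q(t) = \<Prod>(1 - \<lambda>\<^sub>i' t) / \<Prod>\<^bsub>i \<le> j\<^esub>(1 - d\<^sub>i t)\<close> (\<open>divided_difference_eq_coeff\<close>). In terms of \<open>Q\<close> the two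
  conditions read \<open>Q\<^sub>1 = \<rho>'\<close> and \<open>Q\<^sub>2 \<le> \<rho>'\<^sup>2\<close>, and the claim is \<open>Q\<^sub>k \<le> \<rho>' Q\<^bsub>k-1\<^esub>\<close> for all \<open>k \<ge> 1\<close>.

  If all \<open>\<lambda>\<^sub>i\<close> were real, the coefficients of \<open>Q\<close> would be log-concave and the ratios
  \<open>Q\<^sub>k / Q\<^bsub>k-1\<^esub>\<close> decreasing. For complex \<open>\<lambda>\<^sub>i\<close> with nonpositive real parts this holds only in
  steps of two: like those of a stable polynomial, the \<open>2 \<times> 2\<close> minors of the Hurwitz matrix of \<open>Q\<close> are
  nonnegative (\<open>hurwitz_tp2\<close>), whence \<open>Q\<^bsub>k+2\<^esub> / Q\<^bsub>k+1\<^esub> \<le> Q\<^sub>k / Q\<^bsub>k-1\<^esub>\<close>. This is enough, because the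
  conditions control the first two ratios (\<open>hurwitz_tp2_coeffs_nonpos\<close>).\<close>

section \<open>Two-by-two minors of Hurwitz matrices\<close>

text \<open>Extending the coefficients by zero to negative indices spares every recursion below its
  boundary cases.\<close>
definition int_coeff :: "real fps \<Rightarrow> int \<Rightarrow> real" where
  "int_coeff F k = (if k < 0 then 0 else fps_nth F (nat k))"

text \<open>For \<open>c = int_coeff F\<close> the Hurwitz matrix of \<open>F\<close> has the entry \<open>c (2 * j - i)\<close> in row \<open>i\<close> and
  column \<open>j\<close>. The products compared below are the two terms of its minor in rows \<open>i\<close>, \<open>i + r\<close> and
  columns \<open>j\<close>, \<open>j + s\<close>, where \<open>k = 2 * j - (i + r)\<close>. So the definition says that the entries and the
  \<open>2 \<times> 2\<close> minors of that matrix are nonnegative.\<close>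
definition hurwitz_tp2 :: "real fps \<Rightarrow> bool" where
  "hurwitz_tp2 F \<longleftrightarrow> (\<forall>k. 0 \<le> int_coeff F k) \<and>
     (\<forall>k (r::nat) (s::nat). int_coeff F k * int_coeff F (k + int r + 2 * int s)
        \<le> int_coeff F (k + int r) * int_coeff F (k + 2 * int s))"

lemma int_coeff_of_nat [simp]: "int_coeff F (int k) = fps_nth F k"
  by (simp add: int_coeff_def)

lemma int_coeff_one: "int_coeff 1 k = (if k = 0 then 1 else 0)"
  by (simp add: int_coeff_def)

lemma hurwitz_tp2_one: "hurwitz_tp2 1"
  unfolding hurwitz_tp2_def int_coeff_one by auto

text \<open>Write \<open>R i\<close> for row \<open>i\<close> of the Hurwitz matrix of \<open>F\<close>. Since \<open>R (i + 2)\<close> is \<open>R i\<close> shifted by one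
  column, row \<open>i\<close> for \<open>G = (1 + e t + b t\<^sup>2) F\<close> is \<open>S i + e * R (i + 1)\<close> with
  \<open>S i = R i + b * R (i + 2)\<close>. A minor of \<open>G\<close> in rows \<open>i < i'\<close> therefore splits into the four minors
  that take \<open>S\<close> or \<open>e * R\<close> in each row. All are nonnegative combinations of minors of \<open>F\<close>: \<open>S i\<close>
  against \<open>S i'\<close> is expanded by columns, and in the mixed ones the rows that meet stay in order,
  because \<open>i + 2 \<le> i' + 1\<close>. Only the signs of \<open>e\<close> and \<open>b\<close> enter, not those of a discriminant, and
  this is what admits complex eigenvalues.\<close>
lemma hurwitz_tp2_mult_quadratic:
  assumes F: "hurwitz_tp2 F" and e: "0 \<le> e" and b: "0 \<le> b"
    and G: "\<And>k. int_coeff G k = int_coeff F k + e * int_coeff F (k - 1) + b * int_coeff F (k - 2)"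
  shows "hurwitz_tp2 G"
proof -
  define c where "c = int_coeff F"
  have nn: "0 \<le> c k" for k
    using F by (simp add: hurwitz_tp2_def c_def)
  \<comment> \<open>the minor of \<open>F\<close> belonging to the parameters \<open>k\<close>, \<open>r\<close>, \<open>s\<close>\<close>
  define M where "M = (\<lambda>k r s. c (k + r) * c (k + 2 * s) - c k * c (k + r + 2 * s))"
  have M: "0 \<le> M k r s" if "0 \<le> r" "0 \<le> s" for k r s :: int
  proof -
    have "c k * c (k + int (nat r) + 2 * int (nat s)) \<le> c (k + int (nat r)) * c (k + 2 * int (nat s))"
      using F by (simp only: hurwitz_tp2_def c_def)
    then show ?thesis
      using that by (simp add: M_def)
  qed
  define d where "d = int_coeff G"
  have d: "d k = c k + e * c (k - 1) + b * c (k - 2)" for k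
    by (simp add: d_def c_def G)
  have "d k * d (k + int r + 2 * int s) \<le> d (k + int r) * d (k + 2 * int s)" for k r s
  proof (cases "r = 0 \<or> s = 0")
    case True
    then show ?thesis
      by auto
  next
    case False
    define p q where "p = int r" and "q = int s"
    have pq: "1 \<le> p" "1 \<le> q"
      using False by (auto simp: p_def q_def)
    have eq: "d (k + p) * d (k + 2 * q) - d k * d (k + p + 2 * q)
       = M k p q + b\<^sup>2 * M (k - 2) p q + b * (M k p (q - 1) + M (k - 2) p (q + 1))
         + e * (M (k - 1) (p + 1) q + b * M (k - 1) (p - 1) q)
         + e * (M k (p - 1) q + b * M (k - 2) (p + 1) q)
         + e\<^sup>2 * M (k - 1) p q"
      unfolding M_def d power2_eq_square
      by (simp add: algebra_simps)
    have "0 \<le> d (k + p) * d (k + 2 * q) - d k * d (k + p + 2 * q)"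
      unfolding eq using pq e b
      by (intro add_nonneg_nonneg mult_nonneg_nonneg M) auto
    then show ?thesis
      by (simp add: p_def q_def)
  qed
  moreover have "0 \<le> d k" for k
    unfolding d using nn e b by simp
  ultimately show ?thesis
    by (simp add: hurwitz_tp2_def d_def)
qed

text \<open>Dividing by \<open>1 - \<delta> t\<^sup>2\<close> acts on columns: each new column is the old one plus \<open>\<delta>\<close> times the
  preceding new one. Replacing the columns of a minor one at a time, from the left, keeps it
  nonnegative.\<close>
lemma hurwitz_tp2_geometric:
  assumes F: "hurwitz_tp2 F" and \<delta>: "0 \<le> \<delta>"
    and G: "\<And>k. int_coeff G k = int_coeff F k + \<delta> * int_coeff G (k - 2)"
  shows "hurwitz_tp2 G"
proof -
  define c where "c = int_coeff F"
  define d where "d = int_coeff G"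
  have d: "d k = c k + \<delta> * d (k - 2)" for k
    unfolding d_def c_def by (rule G)
  have d0: "d k = 0" if "k < 0" for k
    using that by (simp add: d_def int_coeff_def)
  have nnc: "0 \<le> c k" for k
    using F by (simp add: hurwitz_tp2_def c_def)
  have M: "0 \<le> c (k + int r) * c (k + 2 * int s) - c k * c (k + int r + 2 * int s)" for k r s
    using F by (simp add: hurwitz_tp2_def c_def)
  have nnd': "\<forall>k. k < int m \<longrightarrow> 0 \<le> d k" for m
  proof (induction m)
    case 0
    then show ?case using d0 by simp
  next
    case (Suc m)
    show ?case
    proof (intro allI impI)
      fix k :: int
      assume "k < int (Suc m)"
      then have "0 \<le> d (k - 2)"
        using Suc by simp
      then show "0 \<le> d k"
        unfolding d[of k] using nnc \<delta> by simp
    qed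
  qed
  have nnd: "0 \<le> d k" for k
    using nnd'[of "nat k + 1"] by (cases "k < 0") (simp_all add: d0)
  \<comment> \<open>mixed minors, with a new left column and an old right one, by induction on a bound \<open>m\<close> for the
      larger index of a new entry; it starts because new entries with a negative index vanish\<close>
  have N': "\<forall>k s. k + int r < int m \<longrightarrow>
      0 \<le> d (k + int r) * c (k + 2 * int s) - c (k + int r + 2 * int s) * d k" for m r
  proof (induction m)
    case 0
    then show ?case by (simp add: d0)
  next
    case (Suc m)
    show ?case
    proof (intro allI impI)
      fix k :: int and s :: nat
      assume "k + int r < int (Suc m)"
      then have "0 \<le> d (k - 2 + int r) * c (k - 2 + 2 * int (Suc s))
          - c (k - 2 + int r + 2 * int (Suc s)) * d (k - 2)"
        using Suc[rule_format, of "k - 2" "Suc s"] by simp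
      then have "0 \<le> \<delta> * (d (k - 2 + int r) * c (k + 2 * int s) - c (k + int r + 2 * int s) * d (k - 2))"
        using \<delta> by (intro mult_nonneg_nonneg) (simp_all add: algebra_simps)
      moreover have "d (k + int r) * c (k + 2 * int s) - c (k + int r + 2 * int s) * d k
        = (c (k + int r) * c (k + 2 * int s) - c k * c (k + int r + 2 * int s))
          + \<delta> * (d (k - 2 + int r) * c (k + 2 * int s) - c (k + int r + 2 * int s) * d (k - 2))"
        unfolding d[of "k + int r"] d[of k] by (simp add: algebra_simps)
      ultimately show "0 \<le> d (k + int r) * c (k + 2 * int s) - c (k + int r + 2 * int s) * d k"
        using M[of k r s] by linarith
    qed
  qed
  have N: "0 \<le> d (k + int r) * c (k + 2 * int s) - c (k + int r + 2 * int s) * d k" for k r s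
    using N'[of r "nat (k + int r) + 1"] by simp
  have "0 \<le> d (k + int r) * d (k + 2 * int s) - d k * d (k + int r + 2 * int s)" for k r s
  proof (induction s)
    case 0
    then show ?case by simp
  next
    case (Suc s)
    have "d (k + int r) * d (k + 2 * int (Suc s)) - d k * d (k + int r + 2 * int (Suc s))
      = (d (k + int r) * c (k + 2 * int (Suc s)) - c (k + int r + 2 * int (Suc s)) * d k)
        + \<delta> * (d (k + int r) * d (k + 2 * int s) - d k * d (k + int r + 2 * int s))"
      unfolding d[of "k + 2 * int (Suc s)"] d[of "k + int r + 2 * int (Suc s)"]
      by (simp add: algebra_simps)
    then show ?case
      using Suc N[of k r "Suc s"] \<delta> by simp
  qed
  then show ?thesis
    using nnd by (simp add: hurwitz_tp2_def d_def)
qed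

lemma int_coeff_X_mult: "int_coeff (fps_X * F) k = int_coeff F (k - 1)"
  by (auto simp: int_coeff_def nat_diff_distrib)

lemma int_coeff_const_mult: "int_coeff (fps_const a * F) k = a * int_coeff F k"
  by (simp add: int_coeff_def)

lemma int_coeff_add: "int_coeff (F + G) k = int_coeff F k + int_coeff G k"
  by (simp add: int_coeff_def)

lemma int_coeff_linear_mult:
  "int_coeff ((1 + fps_const e * fps_X) * F) k = int_coeff F k + e * int_coeff F (k - 1)"
  by (simp add: distrib_right mult.assoc int_coeff_add int_coeff_const_mult int_coeff_X_mult)

lemma hurwitz_tp2_mult_linear:
  assumes "hurwitz_tp2 F" and "0 \<le> e"
  shows "hurwitz_tp2 ((1 + fps_const e * fps_X) * F)"
proof (rule hurwitz_tp2_mult_quadratic[OF assms order_refl])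
  show "int_coeff ((1 + fps_const e * fps_X) * F) k
      = int_coeff F k + e * int_coeff F (k - 1) + 0 * int_coeff F (k - 2)" for k
    by (simp add: int_coeff_linear_mult)
qed

text \<open>A pole \<open>d \<ge> 0\<close> reduces to the two preceding operations by
  \<open>1 / (1 - d t) = (1 + d t) / (1 - d\<^sup>2 t\<^sup>2)\<close>.\<close>
lemma hurwitz_tp2_mult_geometric:
  assumes F: "hurwitz_tp2 F" and d: "0 \<le> d"
  shows "hurwitz_tp2 (inverse (1 - fps_const d * fps_X) * F)"
proof (rule hurwitz_tp2_geometric)
  define G where "G = inverse (1 - fps_const d * fps_X) * F"
  show "hurwitz_tp2 ((1 + fps_const d * fps_X) * F)"
    by (rule hurwitz_tp2_mult_linear[OF F d])
  show "0 \<le> d\<^sup>2"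
    by simp
  have "(1 - fps_const d * fps_X) * G = F"
    unfolding G_def mult.assoc[symmetric] by (subst inverse_mult_eq_1') auto
  then have "G = F + fps_const d * (fps_X * G)"
    by (simp add: algebra_simps)
  then have G: "int_coeff G k = int_coeff F k + d * int_coeff G (k - 1)" for k
    by (metis int_coeff_X_mult int_coeff_add int_coeff_const_mult)
  show "int_coeff G k = int_coeff ((1 + fps_const d * fps_X) * F) k + d\<^sup>2 * int_coeff G (k - 2)" for k
    using G[of k] G[of "k - 1"]
    unfolding int_coeff_linear_mult by (simp add: algebra_simps power2_eq_square)
qed

text \<open>Let \<open>c\<close> be the coefficients of \<open>Q\<close>. Only the minors involving \<open>c 0\<close> or \<open>c 1\<close> matter: they bound the ratio of \<open>c k\<close> to
  \<open>c (k - 1)\<close> by \<open>c 1 / c 0 = \<rho>\<close> if \<open>k\<close> is odd and by \<open>c 2 / c 1 \<le> \<rho>\<close> if \<open>k\<close> is even. For \<open>\<rho> = 0\<close> the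
  second bound is void; then \<open>c 2 = 0\<close>, and \<open>c 0 * c k \<le> c 2 * c (k - 2)\<close> takes its place.\<close>
lemma hurwitz_tp2_coeffs_nonpos:
  assumes Q: "hurwitz_tp2 Q" and Q0: "fps_nth Q 0 = 1"
    and Q1: "fps_nth Q 1 = \<rho>" and Q2: "fps_nth Q 2 \<le> \<rho>\<^sup>2" and k: "k \<ge> 1"
  shows "fps_nth ((1 - fps_const \<rho> * fps_X) * Q) k \<le> 0"
proof -
  define c where "c = fps_nth Q"
  have nn: "0 \<le> c k" for k
    using Q unfolding hurwitz_tp2_def c_def by (metis int_coeff_of_nat)
  have tp: "c k * c (k + r + 2 * s) \<le> c (k + r) * c (k + 2 * s)" for k r s
  proof -
    have "int_coeff Q (int k) * int_coeff Q (int k + int r + 2 * int s)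
        \<le> int_coeff Q (int k + int r) * int_coeff Q (int k + 2 * int s)"
      using Q unfolding hurwitz_tp2_def by blast
    moreover have "int k + int r + 2 * int s = int (k + r + 2 * s)" "int k + int r = int (k + r)"
      "int k + 2 * int s = int (k + 2 * s)"
      by simp_all
    ultimately show ?thesis
      by (simp only: int_coeff_of_nat c_def)
  qed
  have c0: "c 0 = 1" and c1: "c 1 = \<rho>" and c2: "c 2 \<le> \<rho>\<^sup>2"
    using Q0 Q1 Q2 by (simp_all add: c_def)
  have \<rho>: "0 \<le> \<rho>"
    using nn[of 1] c1 by simp
  have odd: "c (2 * m + 1) \<le> \<rho> * c (2 * m)" for m
    using tp[of 0 1 m] c0 c1 by simp
  have even: "c (2 * m + 2) \<le> \<rho> * c (2 * m + 1)" for m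
  proof (cases "\<rho> = 0")
    case True
    then have "c 2 = 0"
      using c2 nn[of 2] by simp
    moreover have "c (2 * m + 2) \<le> c 2 * c (2 * m)"
      using tp[of 0 2 m] by (simp only: c0 mult_1_left add_0_left add.commute[of 2])
    ultimately show ?thesis
      using True by simp
  next
    case False
    have "\<rho> * c (2 * m + 2) \<le> c 2 * c (2 * m + 1)"
      using tp[of 1 1 m] c1 by (simp add: numeral_2_eq_2)
    also have "\<dots> \<le> \<rho>\<^sup>2 * c (2 * m + 1)"
      by (rule mult_right_mono[OF c2 nn])
    finally show ?thesis
      using False \<rho> by (simp add: power2_eq_square mult.assoc)
  qed
  obtain j where j: "k = Suc j"
    using k by (cases k) auto
  have "c k \<le> \<rho> * c j"
  proof (cases "even j")
    case True
    then show ?thesis using odd j by (auto elim!: evenE)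
  next
    case False
    then show ?thesis using even j by (auto elim!: oddE)
  qed
  moreover have "fps_nth ((1 - fps_const \<rho> * fps_X) * Q) k = c k - \<rho> * c j"
    by (simp add: left_diff_distrib j c_def mult.assoc)
  ultimately show ?thesis
    by simp
qed

section \<open>Polynomials with roots in the left half-plane\<close>

lemma int_coeff_quadratic_mult:
  "int_coeff ((1 + fps_const e * fps_X + fps_const b * fps_X\<^sup>2) * F) k
    = int_coeff F k + e * int_coeff F (k - 1) + b * int_coeff F (k - 2)"
  by (simp add: distrib_right mult.assoc power2_eq_square
      int_coeff_add int_coeff_const_mult int_coeff_X_mult)

abbreviation reversed_fps :: "'a :: idom poly \<Rightarrow> 'a fps" where
  "reversed_fps p \<equiv> fps_of_poly (reflect_poly p)"

lemma reversed_fps_mult: "reversed_fps (p * q) = reversed_fps p * reversed_fps q"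
  by (simp add: reflect_poly_mult fps_of_poly_mult)

lemma reversed_fps_linear: "reversed_fps [:a, 1:] = 1 + fps_const a * fps_X"
proof (rule fps_ext)
  fix k :: nat
  consider "k = 0" | "k = 1" | "k > 1" by linarith
  then show "fps_nth (reversed_fps [:a, 1:]) k = fps_nth (1 + fps_const a * fps_X) k"
    by cases (auto simp: coeff_reflect_poly)
qed

lemma reversed_fps_quadratic:
  "reversed_fps [:b, e, 1:] = 1 + fps_const e * fps_X + fps_const b * fps_X\<^sup>2"
proof (rule fps_ext)
  fix k :: nat
  consider "k = 0" | "k = 1" | "k = 2" | "k > 2" by linarith
  then show "fps_nth (reversed_fps [:b, e, 1:]) k
      = fps_nth (1 + fps_const e * fps_X + fps_const b * fps_X\<^sup>2) k"
    by cases (auto simp: coeff_reflect_poly power2_eq_square numeral_2_eq_2)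
qed

lemma map_poly_of_real_mult:
  "map_poly complex_of_real (p * q) = map_poly complex_of_real p * map_poly complex_of_real q"
proof -
  interpret map_poly_comm_ring_hom complex_of_real ..
  show ?thesis by (rule hom_mult)
qed

text \<open>Splitting off a real root \<open>r\<close> or a conjugate pair \<open>z\<close>, \<open>cnj z\<close> multiplies the reversed
  polynomial by \<open>1 - r t\<close> or \<open>1 - 2 Re z t + \<bar>z\<bar>\<^sup>2 t\<^sup>2\<close>, whose coefficients are nonnegative.\<close>
lemma real_stable_poly_of_roots:
  assumes "self_conjugate ls" and "\<forall>z\<in>set ls. Re z \<le> 0"
  shows "\<exists>g. map_poly complex_of_real g = (\<Prod>z\<leftarrow>ls. [:- z, 1:]) \<and>
             hurwitz_tp2 (reversed_fps g)"
  using assms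
proof (induction "length ls" arbitrary: ls rule: less_induct)
  case less
  show ?case
  proof (cases ls)
    case Nil
    then show ?thesis
      by (intro exI[of _ 1]) (simp add: hurwitz_tp2_one)
  next
    case (Cons z zs)
    have re: "Re z \<le> 0"
      using less.prems(2) Cons by simp
    show ?thesis
    proof (cases "Im z = 0")
      case True
      then have z: "z = complex_of_real (Re z)"
        by (simp add: complex_eq_iff)
      have "self_conjugate zs"
        using less.prems(1) Cons z self_conjugate_Cons_of_real by metis
      then obtain g where g: "map_poly complex_of_real g = (\<Prod>z\<leftarrow>zs. [:- z, 1:])"
        and tp: "hurwitz_tp2 (reversed_fps g)"
        using less.hyps[of zs] less.prems(2) Cons by auto
      have "map_poly complex_of_real ([:- Re z, 1:] * g) = [:- complex_of_real (Re z), 1:] * map_poly complex_of_real g"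
        unfolding map_poly_of_real_mult by (simp add: map_poly_pCons)
      then have "map_poly complex_of_real ([:- Re z, 1:] * g) = (\<Prod>z\<leftarrow>ls. [:- z, 1:])"
        using g Cons z by simp
      moreover have "hurwitz_tp2 (reversed_fps ([:- Re z, 1:] * g))"
        unfolding reversed_fps_mult reversed_fps_linear
        using re by (intro hurwitz_tp2_mult_linear tp) simp
      ultimately show ?thesis
        by blast
    next
      case False
      then have "cnj z \<noteq> z"
        by (simp add: complex_eq_iff)
      moreover have "cnj z \<in># mset ls"
        using less.prems(1) Cons unfolding self_conjugate_def by (metis list.set_intros(1) list.simps(9) set_mset_mset)
      ultimately have "cnj z \<in> set zs"
        using Cons by auto
      define ws where "ws = remove1 (cnj z) zs"
      have zs: "mset zs = add_mset (cnj z) (mset ws)"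
        using \<open>cnj z \<in> set zs\<close> by (simp add: ws_def)
      have "image_mset cnj (mset zs) = add_mset z (image_mset cnj (mset ws))"
        using zs by simp
      then have "self_conjugate ws"
        using less.prems(1) Cons zs unfolding self_conjugate_def by simp
      moreover have "length ws < length ls"
        using \<open>cnj z \<in> set zs\<close> Cons by (simp add: ws_def length_remove1)
      moreover have "\<forall>w\<in>set ws. Re w \<le> 0"
        using less.prems(2) Cons notin_set_remove1 unfolding ws_def by fastforce
      ultimately obtain g where g: "map_poly complex_of_real g = (\<Prod>z\<leftarrow>ws. [:- z, 1:])"
        and tp: "hurwitz_tp2 (reversed_fps g)"
        using less.hyps[of ws] by auto
      define q where "q = [:(cmod z)\<^sup>2, - 2 * Re z, 1:]"
      have "map_poly complex_of_real q = [:- z, 1:] * [:- cnj z, 1:]"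
        using complex_add_cnj[of z] complex_norm_square[of z]
        by (simp add: q_def map_poly_pCons algebra_simps)
      moreover have "(\<Prod>z\<leftarrow>zs. [:- z, 1:]) = [:- cnj z, 1:] * (\<Prod>z\<leftarrow>ws. [:- z, 1:])"
        using \<open>cnj z \<in> set zs\<close> unfolding ws_def by (rule prod_list_map_remove1)
      ultimately have "map_poly complex_of_real (q * g) = (\<Prod>z\<leftarrow>ls. [:- z, 1:])"
        using g Cons by (simp add: map_poly_of_real_mult mult.assoc del: mult_pCons_left)
      moreover have "hurwitz_tp2 (reversed_fps (q * g))"
        unfolding reversed_fps_mult q_def reversed_fps_quadratic
        by (rule hurwitz_tp2_mult_quadratic[OF tp _ _ int_coeff_quadratic_mult]) (use re in auto)
      ultimately show ?thesis
        by blast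
    qed
  qed
qed

section \<open>The first two coefficients and the power sums\<close>

lemma fps_mult_nth_1: "fps_nth (F * G) 1 = fps_nth F 0 * fps_nth G 1 + fps_nth F 1 * fps_nth G 0"
  by (simp add: fps_mult_nth)

lemma fps_mult_nth_2:
  "fps_nth (F * G) 2 = fps_nth F 0 * fps_nth G 2 + fps_nth F 1 * fps_nth G 1 + fps_nth F 2 * fps_nth G 0"
  by (simp add: fps_mult_nth numeral_2_eq_2)

text \<open>Newton's \<open>p\<^sub>2 = e\<^sub>1\<^sup>2 - 2 e\<^sub>2\<close>, that is, minus twice the coefficient of \<open>t\<^sup>2\<close> in \<open>log F\<close> when
  \<open>F\<close> has constant term 1. It turns products into sums and sends \<open>1 - x t\<close> to \<open>x\<^sup>2\<close>.\<close>
definition newton_p2 :: "'a :: comm_ring_1 fps \<Rightarrow> 'a" where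
  "newton_p2 F = (fps_nth F 1)\<^sup>2 - 2 * fps_nth F 2"

lemma newton_p2_mult:
  assumes "fps_nth F 0 = 1" "fps_nth G 0 = 1"
  shows "newton_p2 (F * G) = newton_p2 F + newton_p2 G"
  unfolding newton_p2_def fps_mult_nth_1 fps_mult_nth_2 assms
  by (simp add: algebra_simps power2_eq_square)

lemma prod_list_fps_low_coeffs:
  assumes "\<And>x. fps_nth (F x) 0 = 1"
  shows "fps_nth (\<Prod>x\<leftarrow>xs. F x) 0 = 1"
    and "fps_nth (\<Prod>x\<leftarrow>xs. F x) 1 = (\<Sum>x\<leftarrow>xs. fps_nth (F x) 1)"
    and "newton_p2 (\<Prod>x\<leftarrow>xs. F x) = (\<Sum>x\<leftarrow>xs. newton_p2 (F x))"
proof -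
  show 0: "fps_nth (\<Prod>x\<leftarrow>xs. F x) 0 = 1" for xs
    by (induction xs) (auto simp: assms)
  show "fps_nth (\<Prod>x\<leftarrow>xs. F x) 1 = (\<Sum>x\<leftarrow>xs. fps_nth (F x) 1)"
    by (induction xs) (simp_all add: fps_mult_nth_1 0 assms del: One_nat_def)
  show "newton_p2 (\<Prod>x\<leftarrow>xs. F x) = (\<Sum>x\<leftarrow>xs. newton_p2 (F x))"
  proof (induction xs)
    case Nil
    show ?case by (simp add: newton_p2_def)
  next
    case (Cons x xs)
    then show ?case by (simp add: newton_p2_mult 0 assms)
  qed
qed

abbreviation geometric_fps :: "'a :: field \<Rightarrow> 'a fps" where
  "geometric_fps d \<equiv> inverse (1 - fps_const d * fps_X)"

lemma geometric_fps_eq: "geometric_fps d = Abs_fps (\<lambda>k. d ^ k)"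
proof -
  have "(1 - fps_const d * fps_X) * Abs_fps (\<lambda>k. d ^ k) = 1"
  proof (rule fps_ext)
    fix k show "fps_nth ((1 - fps_const d * fps_X) * Abs_fps (\<lambda>k. d ^ k)) k = fps_nth 1 k"
      by (cases k) (simp_all add: left_diff_distrib mult.assoc)
  qed
  then show ?thesis
    by (rule fps_inverse_unique)
qed

lemma reversed_fps_of_roots_low_coeffs:
  fixes g :: "real poly"
  assumes g: "map_poly complex_of_real g = (\<Prod>z\<leftarrow>ls. [:- z, 1:])"
  shows "fps_nth (reversed_fps g) 0 = 1"
    and "complex_of_real (fps_nth (reversed_fps g) 1) = - (\<Sum>z\<leftarrow>ls. z)"
    and "complex_of_real (newton_p2 (reversed_fps g)) = (\<Sum>z\<leftarrow>ls. z\<^sup>2)"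
proof -
  have nth: "fps_nth (reversed_fps (map_poly complex_of_real g)) k
      = complex_of_real (fps_nth (reversed_fps g) k)" for k
    by (simp add: coeff_reflect_poly degree_map_poly coeff_map_poly)
  have eq: "reversed_fps (map_poly complex_of_real g) = (\<Prod>z\<leftarrow>ls. 1 + fps_const (- z) * fps_X)"
    unfolding g by (induction ls) (simp_all add: reversed_fps_mult reversed_fps_linear del: mult_pCons_left)
  note low = prod_list_fps_low_coeffs[of "\<lambda>z. 1 + fps_const (- z) * fps_X" ls, folded eq, unfolded nth newton_p2_def]
  show "fps_nth (reversed_fps g) 0 = 1"
    using low(1) by simp
  show "complex_of_real (fps_nth (reversed_fps g) 1) = - (\<Sum>z\<leftarrow>ls. z)"
    using low(2) uminus_sum_list_map[of "\<lambda>z. z" ls] by (simp add: o_def)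
  show "complex_of_real (newton_p2 (reversed_fps g)) = (\<Sum>z\<leftarrow>ls. z\<^sup>2)"
    using low(3) by (simp add: newton_p2_def)
qed

lemma hurwitz_tp2_mult_geometric_list:
  assumes "hurwitz_tp2 F" and "\<forall>d\<in>set ds. 0 \<le> d"
  shows "hurwitz_tp2 ((\<Prod>d\<leftarrow>ds. geometric_fps d) * F)"
  using assms(2)
proof (induction ds)
  case Nil
  then show ?case using assms(1) by simp
next
  case (Cons d ds)
  then show ?case
    using hurwitz_tp2_mult_geometric[of "(\<Prod>d\<leftarrow>ds. geometric_fps d) * F" d] by (simp add: mult.assoc)
qed

text \<open>The quotient of the reversed \<open>g\<close> by the product of the \<open>1 - d t\<close> has the Hurwitz minor
  property, so only its first two coefficients have to be compared with \<open>\<rho>\<close> and \<open>\<rho>\<^sup>2\<close>. By Newton's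
  identities this is the equality of first power sums and the inequality of second power sums.\<close>
lemma quotient_coeffs_nonpos:
  fixes g :: "real poly"
  assumes g: "map_poly complex_of_real g = (\<Prod>z\<leftarrow>ls. [:- z, 1:])"
    and tp: "hurwitz_tp2 (reversed_fps g)"
    and ds: "\<forall>d\<in>set ds. 0 \<le> d"
    and s1: "complex_of_real (\<Sum>d\<leftarrow>ds. d) = of_real \<rho> + (\<Sum>z\<leftarrow>ls. z)"
    and s2: "(\<Sum>d\<leftarrow>ds. d\<^sup>2) \<le> \<rho>\<^sup>2 + Re (\<Sum>z\<leftarrow>ls. z\<^sup>2)"
    and k: "k \<ge> 1"
  shows "fps_nth (reversed_fps ([:- \<rho>, 1:] * g) * (\<Prod>d\<leftarrow>ds. geometric_fps d)) k \<le> 0"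
proof -
  define W where "W = (\<Prod>d\<leftarrow>ds. geometric_fps d)"
  have W0: "fps_nth W 0 = 1" and W1: "fps_nth W 1 = (\<Sum>d\<leftarrow>ds. d)"
    and W2: "newton_p2 W = - (\<Sum>d\<leftarrow>ds. d\<^sup>2)"
    unfolding W_def
    by (subst prod_list_fps_low_coeffs; simp add: geometric_fps_eq newton_p2_def uminus_sum_list_map o_def)+
  note low = reversed_fps_of_roots_low_coeffs[OF g]
  define Q where "Q = W * reversed_fps g"
  have Q0: "fps_nth Q 0 = 1"
    using W0 low(1) by (simp add: Q_def)
  have "complex_of_real (fps_nth Q 1) = of_real \<rho>"
    using W0 W1 low(1,2) s1 by (simp add: Q_def fps_mult_nth_1 del: One_nat_def)
  then have Q1: "fps_nth Q 1 = \<rho>"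
    using of_real_eq_iff by blast
  have "newton_p2 Q = newton_p2 (reversed_fps g) - (\<Sum>d\<leftarrow>ds. d\<^sup>2)"
    unfolding Q_def by (subst newton_p2_mult) (use W0 W2 low(1) in simp_all)
  moreover have "newton_p2 (reversed_fps g) = Re (\<Sum>z\<leftarrow>ls. z\<^sup>2)"
    using low(3) by (metis Re_complex_of_real)
  ultimately have Q2: "fps_nth Q 2 \<le> \<rho>\<^sup>2"
    using s2 Q1 by (simp add: newton_p2_def)
  have "hurwitz_tp2 Q"
    unfolding Q_def W_def by (rule hurwitz_tp2_mult_geometric_list[OF tp ds])
  from hurwitz_tp2_coeffs_nonpos[OF this Q0 Q1 Q2 k]
  have "fps_nth ((1 - fps_const \<rho> * fps_X) * Q) k \<le> 0" .
  moreover have "reversed_fps ([:- \<rho>, 1:] * g) * W = (1 - fps_const \<rho> * fps_X) * Q"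
    unfolding reversed_fps_mult reversed_fps_linear Q_def by (simp add: mult_ac fps_const_neg[symmetric] del: fps_const_neg)
  ultimately show ?thesis
    by (simp add: W_def del: mult_pCons_left)
qed

section \<open>Divided differences\<close>

text \<open>Synthetic division is the operator \<open>p \<mapsto> (p(x) - p(d)) / (x - d)\<close>, so iterating it yields the
  divided difference \<open>p[d\<^sub>1, \<dots>, d\<^sub>m]\<close>, with repeated nodes allowed. The value for the empty list of
  nodes is a dummy.\<close>
fun divided_difference :: "'a :: comm_ring_1 poly \<Rightarrow> 'a list \<Rightarrow> 'a" where
  "divided_difference p [] = 0"
| "divided_difference p [d] = poly p d"
| "divided_difference p (d # ds) = divided_difference (synthetic_div p d) ds"

lemma divided_difference_Cons:
  "ds \<noteq> [] \<Longrightarrow> divided_difference p (d # ds) = divided_difference (synthetic_div p d) ds"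
  by (cases ds) auto

lemma synthetic_div_pcompose_shift:
  fixes p :: "'a :: comm_ring_1 poly"
  shows "synthetic_div (pcompose p [:a, 1:]) (d - a) = pcompose (synthetic_div p d) [:a, 1:]"
proof -
  have "pcompose p [:a, 1:] = pcompose ([:- d, 1:] * synthetic_div p d + [:poly p d:]) [:a, 1:]"
    by (simp add: synthetic_div_correct' del: mult_pCons_left)
  also have "\<dots> = [:a - d, 1:] * pcompose (synthetic_div p d) [:a, 1:] + [:poly p d:]"
    unfolding pcompose_add pcompose_mult by (simp add: pcompose_pCons del: mult_pCons_left)
  finally have "pcompose p [:a, 1:] + Polynomial.smult (d - a) (pcompose (synthetic_div p d) [:a, 1:])
      = pCons (poly p d) (pcompose (synthetic_div p d) [:a, 1:])"
    by (simp add: algebra_simps smult_diff_left del: pcompose_pCons)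
  then show ?thesis
    using synthetic_div_unique by metis
qed

lemma divided_difference_shift:
  "divided_difference (pcompose p [:a, 1:]) (map (\<lambda>d. d - a) ds) = divided_difference p ds"
proof (induction p ds rule: divided_difference.induct)
  case (3 p d e ds)
  then show ?case
    by (simp add: synthetic_div_pcompose_shift)
qed (simp_all add: poly_pcompose)

lemma reversed_fps_synthetic_div:
  fixes p :: "real poly"
  assumes "degree p \<ge> 1"
  shows "reversed_fps p = (1 - fps_const d * fps_X) * reversed_fps (synthetic_div p d)
            + fps_const (poly p d) * fps_X ^ degree p"
proof (rule fps_ext)
  fix k
  define q where "q = synthetic_div p d"
  have deg: "degree p = Suc (degree q)"
    using assms by (simp add: q_def degree_synthetic_div)
  have "fps_nth (reversed_fps p) k = fps_nth (reversed_fps ([:- d, 1:] * q + [:poly p d:])) k"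
    by (simp add: q_def synthetic_div_correct' del: mult_pCons_left)
  also have "\<dots> = fps_nth (reversed_fps ([:- d, 1:] * q)) k + (if k = degree p then poly p d else 0)"
  proof -
    have "degree ([:- d, 1:] * q) = degree p"
    proof -
      have "q \<noteq> 0"
        using assms by (simp add: q_def synthetic_div_eq_0_iff)
      then show ?thesis
        using degree_mult_eq[of "[:- d, 1:]" q] deg by (simp del: mult_pCons_left)
    qed
    moreover have "coeff p i = coeff ([:- d, 1:] * q) i + (if i = 0 then poly p d else 0)" for i
      by (subst synthetic_div_correct'[of d p, folded q_def, symmetric])
        (simp add: coeff_pCons split: nat.splits del: mult_pCons_left)
    ultimately show ?thesis
      by (auto simp: synthetic_div_correct' q_def coeff_reflect_poly simp del: mult_pCons_left)
  qed
  finally show "fps_nth (reversed_fps p) k = fps_nth ((1 - fps_const d * fps_X) * reversed_fps (synthetic_div p d)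
            + fps_const (poly p d) * fps_X ^ degree p) k"
    unfolding reversed_fps_mult reversed_fps_linear q_def
    by (simp add: fps_const_neg[symmetric] del: fps_const_neg)
qed

text \<open>With \<open>q = synthetic_div p d\<close> and \<open>n\<close> the degree of \<open>p\<close>, reversing \<open>p = (x - d) q + p(d)\<close> and
  dividing by \<open>1 - d t\<close> gives the reversed \<open>q\<close> plus \<open>p(d) t\<^sup>n / (1 - d t)\<close>. The last term only matters
  for the coefficient of \<open>t\<^sup>n\<close>, which is inspected when \<open>d\<close> is the only node left; for more nodes a
  lower coefficient is at stake, and \<open>q\<close> carries on with the remaining nodes.\<close>
lemma divided_difference_eq_coeff:
  fixes p :: "real poly"
  assumes "ds \<noteq> []" and "length ds \<le> degree p"
  shows "divided_difference p ds
    = fps_nth (reversed_fps p * (\<Prod>d\<leftarrow>ds. geometric_fps d)) (degree p + 1 - length ds)"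
  using assms
proof (induction ds arbitrary: p)
  case (Cons d ds)
  define W where "W = (\<Prod>d\<leftarrow>ds. geometric_fps d)"
  define q where "q = synthetic_div p d"
  define k where "k = degree p - length ds"
  have deg: "degree p = Suc (degree q)"
    using Cons.prems by (simp add: q_def degree_synthetic_div)
  have inv: "(1 - fps_const d * fps_X) * geometric_fps d = 1"
    by (rule inverse_mult_eq_1') simp
  have rearrange: "(A * R + B * X) * (G * W) = (A * G) * (R * W) + B * (X * (G * W))"
    for A B G R X :: "real fps"
    by (simp add: algebra_simps)
  have "reversed_fps p * (geometric_fps d * W)
     = ((1 - fps_const d * fps_X) * geometric_fps d) * (reversed_fps q * W)
       + fps_const (poly p d) * (fps_X ^ degree p * (geometric_fps d * W))"
    unfolding rearrange[symmetric] using deg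
    by (subst reversed_fps_synthetic_div[of p d, folded q_def]) simp_all
  then have split: "fps_nth (reversed_fps p * (geometric_fps d * W)) k = fps_nth (reversed_fps q * W) k
      + poly p d * (if k < degree p then 0 else fps_nth (geometric_fps d * W) (k - degree p))"
    by (simp add: inv fps_X_power_mult_nth)
  show ?case
  proof (cases "ds = []")
    case True
    have "fps_nth (reversed_fps q) (degree p) = 0"
      by (simp add: coeff_reflect_poly deg)
    then show ?thesis
      using split True by (simp add: k_def W_def geometric_fps_eq)
  next
    case False
    then have "k < degree p" and "degree q + 1 - length ds = k"
      using Cons.prems deg by (simp_all add: k_def)
    moreover have "divided_difference q ds = fps_nth (reversed_fps q * W) (degree q + 1 - length ds)"
      unfolding W_def using False Cons.prems deg by (intro Cons.IH) simp_all
    ultimately show ?thesis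
      using split False
      by (simp add: divided_difference_Cons q_def[symmetric] W_def[symmetric])
        (simp add: k_def)
  qed
qed simp

section \<open>The characteristic polynomial of the companion form\<close>

lemma companion_form_carrier [simp]: "companion_form \<Delta> b \<in> carrier_mat (length \<Delta>) (length \<Delta>)"
  by (simp add: companion_form_def Let_def)

text \<open>Laplace expansion along the first column, which has at most two nonzero entries. Deleting
  the first row and column leaves the matrix for the shorter list; deleting the last row and first
  column leaves a lower triangular matrix with \<open>- 1\<close> on the diagonal, whose sign cancels that of
  the cofactor.\<close>
lemma char_poly_companion_form_Cons:
  assumes "\<Delta> \<noteq> []"
  shows "char_poly (companion_form (a # \<Delta>) b)
    = [:- a, 1:] * char_poly (companion_form \<Delta> b) - [:b (length \<Delta> + 1):]"
proof -
  define m where "m = length \<Delta>"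
  have m: "m \<ge> 1"
    using assms by (cases \<Delta>) (auto simp: m_def)
  define M where "M = char_poly_matrix (companion_form (a # \<Delta>) b)"
  have M: "M \<in> carrier_mat (Suc m) (Suc m)"
    unfolding M_def by (rule char_poly_matrix_closed) (metis companion_form_carrier length_Cons m_def)
  have M_nth: "M $$ (i, j) = (if i = j then [:- ((a # \<Delta>) ! i), 1:] else if j = i + 1 then [:- 1:]
       else if i = m then [:- b (Suc m - j):] else 0)" if "i < Suc m" "j < Suc m" for i j
    using that by (auto simp: M_def char_poly_matrix_def companion_form_def Let_def m_def)
  have "det M = (\<Sum>i<Suc m. M $$ (i, 0) * cofactor M i 0)"
    by (rule laplace_expansion_column[OF M]) simp
  also have "\<dots> = (\<Sum>i\<in>{0, m}. M $$ (i, 0) * cofactor M i 0)"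
    by (rule sum.mono_neutral_right) (auto simp: M_nth)
  also have "\<dots> = M $$ (0, 0) * cofactor M 0 0 + M $$ (m, 0) * cofactor M m 0"
    using m by simp
  also have "M $$ (0, 0) = [:- a, 1:]"
    by (simp add: M_nth)
  also have "M $$ (m, 0) = [:- b (m + 1):]"
    using m by (simp add: M_nth)
  also have "cofactor M 0 0 = char_poly (companion_form \<Delta> b)"
  proof -
    have "mat_delete M 0 0 = char_poly_matrix (companion_form \<Delta> b)"
    proof (rule eq_matI)
      fix i j
      assume "i < dim_row (char_poly_matrix (companion_form \<Delta> b))"
        "j < dim_col (char_poly_matrix (companion_form \<Delta> b))"
      then have ij: "i < m" "j < m"
        by (simp_all add: char_poly_matrix_def companion_form_def Let_def m_def)
      then show "mat_delete M 0 0 $$ (i, j) = char_poly_matrix (companion_form \<Delta> b) $$ (i, j)"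
        using M by (auto simp: mat_delete_def M_nth)
          (auto simp: char_poly_matrix_def companion_form_def Let_def m_def)
    qed (use M in \<open>auto simp: char_poly_matrix_def companion_form_def Let_def m_def\<close>)
    then show ?thesis
      by (simp add: cofactor_def char_poly_def)
  qed
  also have "cofactor M m 0 = 1"
  proof -
    have D: "mat_delete M m 0 \<in> carrier_mat m m"
      using mat_delete_carrier[OF M, of m 0] by simp
    have nth: "mat_delete M m 0 $$ (i, j) = M $$ (i, Suc j)" if "i < m" "j < m" for i j
      using that M by (simp add: mat_delete_def)
    have "det (mat_delete M m 0) = prod_list (diag_mat (mat_delete M m 0))"
      by (rule det_lower_triangular[OF _ D]) (simp add: nth M_nth)
    also have "diag_mat (mat_delete M m 0) = replicate m (- 1)"
      using D by (intro nth_equalityI) (auto simp: diag_mat_def nth M_nth one_pCons)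
    finally show ?thesis
      by (simp add: cofactor_def prod_list_replicate flip: power_add mult_2 power_mult_distrib)
  qed
  finally show ?thesis
    by (simp add: char_poly_def M_def m_def)
qed

lemma char_poly_companion_form_singleton: "char_poly (companion_form [a] b) = [:- a, 1:]"
  by (simp add: char_poly_defs companion_form_def Let_def det_single)

text \<open>The recursion for the characteristic polynomial is synthetic division by \<open>x - a\<close> with
  remainder \<open>- b\<close>. At the end a monic linear factor is left over; it is \<open>x\<close> minus the last diagonal
  entry exactly if the divided difference over all of \<open>\<Delta>\<close> vanishes.\<close>
lemma companion_form_realizes:
  fixes f :: "real poly"
  assumes "\<Delta> \<noteq> []" and "lead_coeff f = 1" and "degree f = length \<Delta>"
    and "divided_difference f \<Delta> = 0"
    and "\<And>k. k \<in> {2..length \<Delta>} \<Longrightarrow> b k = - divided_difference f (take (length \<Delta> + 1 - k) \<Delta>)"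
  shows "char_poly (companion_form \<Delta> b) = f"
  using assms
proof (induction \<Delta> arbitrary: f)
  case Nil
  then show ?case by simp
next
  case (Cons a \<Delta>)
  define q where "q = synthetic_div f a"
  have f: "f = [:- a, 1:] * q + [:poly f a:]"
    by (simp add: q_def synthetic_div_correct' del: mult_pCons_left)
  have degq: "degree q = length \<Delta>"
    using Cons.prems(3) by (simp add: q_def degree_synthetic_div)
  have lead: "lead_coeff q = 1"
  proof -
    have "coeff f (Suc (degree q)) = coeff q (degree q)"
      by (subst f) (simp add: coeff_eq_0)
    then show ?thesis
      using Cons.prems(2,3) degq by simp
  qed
  show ?case
  proof (cases "\<Delta> = []")
    case True
    then obtain c where "q = [:c:]"
      using degq by (metis degree_eq_zeroE list.size(3))
    then have "q = 1"
      using lead by (simp add: one_pCons)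
    then show ?thesis
      using f True Cons.prems(4) by (simp add: char_poly_companion_form_singleton)
  next
    case False
    have dd: "divided_difference f (a # take k \<Delta>) = divided_difference q (take k \<Delta>)" if "k \<ge> 1" for k
      unfolding q_def using that False by (intro divided_difference_Cons) simp
    have "char_poly (companion_form \<Delta> b) = q"
    proof (rule Cons.IH[OF False lead degq])
      show "divided_difference q \<Delta> = 0"
        using Cons.prems(4) False by (simp add: divided_difference_Cons q_def)
      show "b k = - divided_difference q (take (length \<Delta> + 1 - k) \<Delta>)" if "k \<in> {2..length \<Delta>}" for k
        using Cons.prems(5)[of k] dd[of "length \<Delta> + 1 - k"] that by (simp add: Suc_diff_le)
    qed
    moreover have "b (length \<Delta> + 1) = - poly f a"
      using Cons.prems(5)[of "length \<Delta> + 1"] False by (simp add: Suc_le_eq)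
    ultimately show ?thesis
      using f char_poly_companion_form_Cons[OF False, of a b] by (simp flip: add_uminus_conv_diff)
  qed
qed

section \<open>Necessity: traces of the first two powers\<close>

lemma sum_list_diag_mat: "A \<in> carrier_mat n n \<Longrightarrow> sum_list (diag_mat A) = (\<Sum>i<n. A $$ (i, i))"
  by (simp add: diag_mat_def interv_sum_list_conv_sum_set_nat atLeast0LessThan)

lemma sum_list_diag_mat_mult:
  fixes A B :: "'a :: comm_ring_1 mat"
  assumes "A \<in> carrier_mat n n" "B \<in> carrier_mat n n"
  shows "sum_list (diag_mat (A * B)) = (\<Sum>i<n. \<Sum>j<n. A $$ (i, j) * B $$ (j, i))"
  using assms by (simp add: sum_list_diag_mat[of _ n] scalar_prod_def atLeast0LessThan)

lemma sum_list_diag_mat_mult_commute: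
  fixes A B :: "'a :: comm_ring_1 mat"
  assumes "A \<in> carrier_mat n n" "B \<in> carrier_mat n n"
  shows "sum_list (diag_mat (A * B)) = sum_list (diag_mat (B * A))"
  unfolding sum_list_diag_mat_mult[OF assms] sum_list_diag_mat_mult[OF assms(2,1)]
  by (subst sum.swap) (simp add: mult.commute)

lemma trace_conjugate:
  fixes B :: "'a :: comm_ring_1 mat"
  assumes B: "B \<in> carrier_mat n n" and P: "P \<in> carrier_mat n n" and Q: "Q \<in> carrier_mat n n"
    and QP: "Q * P = 1\<^sub>m n"
  shows "sum_list (diag_mat (P * B * Q)) = sum_list (diag_mat B)"
proof -
  have "sum_list (diag_mat (P * B * Q)) = sum_list (diag_mat (Q * (P * B)))"
    using B P Q by (intro sum_list_diag_mat_mult_commute) auto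
  also have "Q * (P * B) = B"
    using B P Q QP by (simp flip: assoc_mult_mat[of Q n n P n B n])
  finally show ?thesis .
qed

text \<open>The matrix is conjugate to an upper triangular one with diagonal \<open>es\<close>, by Schur's theorem,
  and the trace is invariant under conjugation.\<close>
lemma trace_powers_eq_power_sums:
  fixes A :: "complex mat"
  assumes A: "A \<in> carrier_mat n n" and es: "char_poly A = (\<Prod>e\<leftarrow>es. [:- e, 1:])"
  shows "(\<Sum>i<n. A $$ (i, i)) = (\<Sum>e\<leftarrow>es. e)"
    and "(\<Sum>i<n. \<Sum>j<n. A $$ (i, j) * A $$ (j, i)) = (\<Sum>e\<leftarrow>es. e\<^sup>2)"
proof -
  obtain B P Q where schur: "schur_decomposition A es = (B, P, Q)"
    by (metis prod_cases3)
  have sim: "similar_mat_wit A B P Q" and ut: "upper_triangular B" and diag: "diag_mat B = es"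
    using schur_decomposition[OF A es schur] by auto
  have QP: "Q * P = 1\<^sub>m n" and APQ: "A = P * B * Q" and B: "B \<in> carrier_mat n n"
    and P: "P \<in> carrier_mat n n" and Q: "Q \<in> carrier_mat n n"
    using similar_mat_witD2[OF A sim] by auto
  have "sum_list (diag_mat A) = sum_list es"
    unfolding APQ trace_conjugate[OF B P Q QP] diag ..
  then show "(\<Sum>i<n. A $$ (i, i)) = (\<Sum>e\<leftarrow>es. e)"
    using A by (simp add: sum_list_diag_mat)
  have "A * A = P * B * (Q * P) * B * Q"
    unfolding APQ using B P Q by (simp add: assoc_mult_mat[of _ n n _ n _ n])
  also have "\<dots> = P * (B * B) * Q"
    unfolding QP using B P Q by (simp add: assoc_mult_mat[of _ n n _ n _ n])
  finally have "sum_list (diag_mat (A * A)) = sum_list (diag_mat (B * B))"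
    using trace_conjugate[OF mult_carrier_mat[OF B B] P Q QP] by simp
  also have "\<dots> = (\<Sum>i<n. \<Sum>j<n. if j = i then (B $$ (i, i))\<^sup>2 else 0)"
    unfolding sum_list_diag_mat_mult[OF B B]
  proof (intro sum.cong refl)
    fix i j assume "i \<in> {..<n}" "j \<in> {..<n}"
    then show "B $$ (i, j) * B $$ (j, i) = (if j = i then (B $$ (i, i))\<^sup>2 else 0)"
      using upper_triangularD[OF ut, of i j] upper_triangularD[OF ut, of j i] B
      by (cases i j rule: linorder_cases) (auto simp: power2_eq_square)
  qed
  also have "\<dots> = (\<Sum>i<n. (diag_mat B ! i)\<^sup>2)"
    using B by (intro sum.cong) (auto simp: diag_mat_def)
  also have "\<dots> = (\<Sum>e\<leftarrow>es. e\<^sup>2)"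
    using B by (simp add: sum_list_sum_nth diag atLeast0LessThan flip: diag) (simp add: diag_mat_def)
  finally show "(\<Sum>i<n. \<Sum>j<n. A $$ (i, j) * A $$ (j, i)) = (\<Sum>e\<leftarrow>es. e\<^sup>2)"
    unfolding sum_list_diag_mat_mult[OF A A] .
qed

lemma proots_linear_factors:
  "proots (\<Prod>z\<leftarrow>zs. [:- z, 1:]) = mset (zs :: 'a :: idom list)"
proof (induction zs)
  case (Cons z zs)
  have "(\<Prod>z\<leftarrow>zs. [:- z, 1:]) \<noteq> 0"
    by (induction zs) (auto simp del: mult_pCons_left)
  then show ?case
    using Cons by (simp add: proots_mult del: mult_pCons_left)
qed simp

lemma power_sum_cong_mset:
  assumes "mset xs = mset ys"
  shows "power_sum k xs = power_sum k ys"
  unfolding power_sum_def using assms by (metis mset_map sum_mset_sum_list)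

text \<open>For a nonnegative matrix the trace of \<open>A\<^sup>2\<close> is a sum of nonnegative products, among which are
  the squares of the diagonal entries.\<close>
lemma nonneg_realization_imp_power_sums:
  assumes A: "A \<in> carrier_mat n n" and nonneg: "nonneg_mat A"
    and diag: "mset (diag_mat A) = mset \<Delta>"
    and spec: "spectrum_mset (map_mat complex_of_real A) = mset \<sigma>"
  shows "complex_of_real (power_sum 1 \<Delta>) = power_sum 1 \<sigma>"
    and "power_sum 2 \<Delta> \<le> Re (power_sum 2 \<sigma>)"
proof -
  let ?A = "map_mat complex_of_real A"
  have A': "?A \<in> carrier_mat n n"
    using A by simp
  obtain es where es: "char_poly ?A = (\<Prod>e\<leftarrow>es. [:- e, 1:])"
    using char_poly_factorized[OF A'] by blast
  then have "mset es = mset \<sigma>"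
    using spec unfolding spectrum_mset_def by (simp add: proots_linear_factors)
  then have \<sigma>: "power_sum k \<sigma> = (\<Sum>e\<leftarrow>es. e ^ k)" for k
    using power_sum_cong_mset[of es \<sigma> k] by (simp add: power_sum_def)
  have \<Delta>: "power_sum k \<Delta> = (\<Sum>i<n. (A $$ (i, i)) ^ k)" for k
  proof -
    have "power_sum k \<Delta> = power_sum k (diag_mat A)"
      by (rule power_sum_cong_mset[OF diag[symmetric]])
    also have "\<dots> = (\<Sum>i<n. (A $$ (i, i)) ^ k)"
      using A by (simp add: power_sum_def diag_mat_def interv_sum_list_conv_sum_set_nat
          atLeast0LessThan o_def)
    finally show ?thesis .
  qed
  show "complex_of_real (power_sum 1 \<Delta>) = power_sum 1 \<sigma>"
    unfolding \<sigma> \<Delta> using trace_powers_eq_power_sums(1)[OF A' es] A by simp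
  have "power_sum 2 \<Delta> \<le> (\<Sum>i<n. \<Sum>j<n. A $$ (i, j) * A $$ (j, i))"
    unfolding \<Delta>
  proof (rule sum_mono)
    fix i assume "i \<in> {..<n}"
    then show "(A $$ (i, i))\<^sup>2 \<le> (\<Sum>j<n. A $$ (i, j) * A $$ (j, i))"
      using member_le_sum[of i "{..<n}" "\<lambda>j. A $$ (i, j) * A $$ (j, i)"] A nonneg
      by (simp add: nonneg_mat_def power2_eq_square)
  qed
  also have "complex_of_real \<dots> = power_sum 2 \<sigma>"
    unfolding \<sigma> using trace_powers_eq_power_sums(2)[OF A' es] A by simp
  then have "(\<Sum>i<n. \<Sum>j<n. A $$ (i, j) * A $$ (j, i)) = Re (power_sum 2 \<sigma>)"
    by (metis Re_complex_of_real)
  finally show "power_sum 2 \<Delta> \<le> Re (power_sum 2 \<sigma>)" .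
qed

section \<open>Sufficiency: the sign of the divided differences\<close>

lemma sum_list_shift:
  "(\<Sum>x\<leftarrow>xs. x - a) = (\<Sum>x\<leftarrow>xs. x) - of_nat (length xs) * (a :: 'a :: comm_ring_1)"
  by (induction xs) (simp_all add: algebra_simps)

lemma sum_list_square_shift:
  "(\<Sum>x\<leftarrow>xs. (x - a)\<^sup>2) = (\<Sum>x\<leftarrow>xs. x\<^sup>2) - 2 * a * (\<Sum>x\<leftarrow>xs. x)
     + of_nat (length xs) * (a :: 'a :: comm_ring_1)\<^sup>2"
  by (induction xs) (simp_all add: algebra_simps power2_eq_square)

lemma self_conjugate_shift:
  assumes "self_conjugate ls"
  shows "self_conjugate (map (\<lambda>z. z - complex_of_real a) ls)"
proof -
  have "mset (map cnj (map (\<lambda>z. z - complex_of_real a) ls))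
      = image_mset (\<lambda>z. z - complex_of_real a) (mset (map cnj ls))"
    by (simp add: o_def multiset.map_comp)
  then show ?thesis
    using assms by (simp add: self_conjugate_def)
qed

lemma real_poly_of_shifted_roots:
  assumes "map_poly complex_of_real f = (\<Prod>z\<leftarrow>zs. [:- z, 1:])"
    and "map_poly complex_of_real f' = (\<Prod>z\<leftarrow>map (\<lambda>z. z - complex_of_real a) zs. [:- z, 1:])"
  shows "f' = pcompose f [:a, 1:]"
proof -
  have "poly f' x = poly f (a + x)" for x
  proof -
    have "complex_of_real (poly f' x) = (\<Prod>z\<leftarrow>zs. complex_of_real (a + x) - z)"
      unfolding of_real_hom.poly_map_poly[symmetric] assms(2)
      by (simp add: poly_prod_list o_def algebra_simps)
    also have "\<dots> = complex_of_real (poly f (a + x))"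
      unfolding of_real_hom.poly_map_poly[symmetric] assms(1)
      by (simp add: poly_prod_list o_def algebra_simps)
    finally show ?thesis
      using of_real_eq_iff by blast
  qed
  then have "poly f' = poly (pcompose f [:a, 1:])"
    by (auto simp: poly_pcompose)
  then show ?thesis
    by (simp add: poly_eq_poly_eq_iff)
qed

text \<open>The divided difference over the first \<open>j\<close> nodes does not involve the other \<open>N\<close> nodes, which
  may thus be replaced by their mean \<open>a\<close>. This keeps the first power sum and does not increase the
  second. Moving the origin to \<open>a\<close> then turns these \<open>N\<close> nodes into zeros, which drop out of the
  quotient of power series; the first \<open>j\<close> nodes remain nonnegative because the list is decreasing,
  and the roots move further to the left because \<open>0 \<le> a\<close>.\<close>
lemma divided_difference_nonpos:
  fixes f :: "real poly"
  assumes \<Delta>: "sorted_wrt (\<ge>) \<Delta>" "\<forall>a\<in>set \<Delta>. a \<ge> 0"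
    and ls: "self_conjugate ls" "\<forall>z\<in>set ls. Re z \<le> 0"
    and len: "length \<Delta> = length ls + 1"
    and f: "map_poly complex_of_real f = (\<Prod>z\<leftarrow>complex_of_real \<rho> # ls. [:- z, 1:])"
    and s1: "complex_of_real (\<Sum>d\<leftarrow>\<Delta>. d) = of_real \<rho> + (\<Sum>z\<leftarrow>ls. z)"
    and s2: "(\<Sum>d\<leftarrow>\<Delta>. d\<^sup>2) \<le> \<rho>\<^sup>2 + Re (\<Sum>z\<leftarrow>ls. z\<^sup>2)"
    and j: "1 \<le> j" "j < length \<Delta>"
  shows "divided_difference f (take j \<Delta>) \<le> 0"
proof -
  define N where "N = length \<Delta> - j"
  define hs ts where "hs = take j \<Delta>" and "ts = drop j \<Delta>"
  have \<Delta>_eq: "\<Delta> = hs @ ts" and lhs: "length hs = j" and lts: "length ts = N" and N: "N \<ge> 1"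
    using j by (simp_all add: hs_def ts_def N_def)
  define a where "a = sum_list ts / real N"
  have sum_ts: "sum_list ts = real N * a"
    using N by (simp add: a_def)
  have a0: "0 \<le> a"
    unfolding a_def using \<Delta>(2) \<Delta>_eq by (auto intro!: divide_nonneg_nonneg sum_list_nonneg)
  have a_le: "a \<le> d" if "d \<in> set hs" for d
  proof -
    have "sum_list ts \<le> (\<Sum>t\<leftarrow>ts. d)"
      using \<Delta>(1) that unfolding \<Delta>_eq sorted_wrt_append
      by (metis (no_types, lifting) list.map_ident sum_list_mono)
    then show ?thesis
      using N sum_ts lts by (simp add: sum_list_triv)
  qed
  have "0 \<le> (\<Sum>t\<leftarrow>ts. (t - a)\<^sup>2)"
    by (intro sum_list_nonneg) auto
  then have ts2: "real N * a\<^sup>2 \<le> (\<Sum>t\<leftarrow>ts. t\<^sup>2)"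
    unfolding sum_list_square_shift using sum_ts
    by (simp add: lts) (simp add: power2_eq_square algebra_simps)
  \<comment> \<open>the nodes and roots in the coordinate with origin \<open>a\<close>\<close>
  define ds where "ds = map (\<lambda>d. d - a) hs"
  define ls' where "ls' = map (\<lambda>z. z - complex_of_real a) ls"
  obtain g where g: "map_poly complex_of_real g = (\<Prod>z\<leftarrow>ls'. [:- z, 1:])"
    and tp: "hurwitz_tp2 (reversed_fps g)"
    using real_stable_poly_of_roots[of ls'] self_conjugate_shift[OF ls(1)] ls(2) a0
    by (fastforce simp: ls'_def)
  define f' where "f' = [:- (\<rho> - a), 1:] * g"
  have "map_poly complex_of_real f' = (\<Prod>z\<leftarrow>map (\<lambda>z. z - complex_of_real a) (complex_of_real \<rho> # ls). [:- z, 1:])"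
    unfolding f'_def map_poly_of_real_mult g by (simp add: ls'_def map_poly_pCons)
  then have f': "f' = pcompose f [:a, 1:]"
    by (rule real_poly_of_shifted_roots[OF f])
  have degf: "degree f' = length \<Delta>"
  proof -
    have "degree f = degree (map_poly complex_of_real f)"
      by (simp add: degree_map_poly)
    also have "\<dots> = length \<Delta>"
      unfolding f using degree_linear_factors[of uminus "complex_of_real \<rho> # ls"] len by simp
    finally show ?thesis
      unfolding f' by (simp add: degree_pcompose)
  qed
  have s1r: "(\<Sum>d\<leftarrow>\<Delta>. d) = \<rho> + Re (\<Sum>z\<leftarrow>ls. z)"
    using s1 by (metis Re_complex_of_real plus_complex.sel(1))
  have "divided_difference f hs = divided_difference f' ds"
    unfolding f' ds_def by (rule divided_difference_shift[symmetric])
  also have "\<dots> = fps_nth (reversed_fps f' * (\<Prod>d\<leftarrow>ds. geometric_fps d)) (degree f' + 1 - length ds)"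
    by (rule divided_difference_eq_coeff) (use j degf lhs in \<open>auto simp: ds_def\<close>)
  also have "\<dots> \<le> 0"
    unfolding f'_def
  proof (rule quotient_coeffs_nonpos[OF g tp])
    show "\<forall>d\<in>set ds. 0 \<le> d"
      using a_le by (auto simp: ds_def)
    have lengths: "real (length ls) = real j + real N - 1"
      using j len by (simp add: N_def)
    then have lengths': "of_nat (length ls) = complex_of_real (real j + real N - 1)"
      by (metis of_real_of_nat_eq)
    have "(\<Sum>d\<leftarrow>ds. d) = (\<Sum>d\<leftarrow>\<Delta>. d) - (real j + real N) * a"
      using sum_list_shift[of a hs] sum_ts lhs by (simp add: ds_def \<Delta>_eq algebra_simps)
    then have "complex_of_real (\<Sum>d\<leftarrow>ds. d)
        = complex_of_real (\<Sum>d\<leftarrow>\<Delta>. d) - of_real ((real j + real N) * a)"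
      by (simp only: of_real_diff)
    also have "\<dots> = of_real (\<rho> - a) + (\<Sum>z\<leftarrow>ls'. z)"
      unfolding s1 ls'_def map_map o_def sum_list_shift lengths'
      by (simp add: algebra_simps)
    finally show "complex_of_real (\<Sum>d\<leftarrow>ds. d) = of_real (\<rho> - a) + (\<Sum>z\<leftarrow>ls'. z)" .
    have "(\<Sum>d\<leftarrow>ds. d\<^sup>2) = (\<Sum>d\<leftarrow>hs. d\<^sup>2) - 2 * a * (\<Sum>d\<leftarrow>hs. d) + real j * a\<^sup>2"
      using sum_list_square_shift[of a hs] lhs by (simp add: ds_def o_def)
    moreover have "Re (\<Sum>z\<leftarrow>ls'. z\<^sup>2) = Re (\<Sum>z\<leftarrow>ls. z\<^sup>2) - 2 * a * Re (\<Sum>z\<leftarrow>ls. z) + (real j + real N - 1) * a\<^sup>2"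
      using sum_list_square_shift[of "complex_of_real a" ls] lengths
      by (simp add: ls'_def o_def power2_eq_square)
    moreover have "2 * a * (\<Sum>d\<leftarrow>hs. d) = 2 * a * (\<rho> + Re (\<Sum>z\<leftarrow>ls. z) - real N * a)"
      using s1r sum_ts by (simp add: \<Delta>_eq)
    moreover have "(\<Sum>d\<leftarrow>hs. d\<^sup>2) + real N * a\<^sup>2 \<le> \<rho>\<^sup>2 + Re (\<Sum>z\<leftarrow>ls. z\<^sup>2)"
      using s2 ts2 by (simp add: \<Delta>_eq)
    ultimately show "(\<Sum>d\<leftarrow>ds. d\<^sup>2) \<le> (\<rho> - a)\<^sup>2 + Re (\<Sum>z\<leftarrow>ls'. z\<^sup>2)"
      by (simp add: algebra_simps power2_eq_square)
    show "1 \<le> degree ([:- (\<rho> - a), 1:] * g) + 1 - length ds"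
      using degf lhs j unfolding f'_def by (simp add: ds_def del: mult_pCons_left)
  qed
  finally show ?thesis
    by (simp add: hs_def)
qed

text \<open>The entries \<open>b k\<close> are forced: they are the negated divided differences over the first
  \<open>n + 1 - k\<close> nodes, where \<open>n\<close> is the length of \<open>\<Delta>\<close>. The divided difference over all nodes is the
  difference of the first power sums and thus zero.\<close>
lemma companion_form_realization:
  fixes \<Delta> :: "real list"
  assumes \<Delta>: "sorted_wrt (\<ge>) \<Delta>" "\<forall>a\<in>set \<Delta>. a \<ge> 0"
    and ls: "self_conjugate ls" "\<forall>z\<in>set ls. Re z \<le> 0"
    and len: "length \<Delta> = length ls + 1"
    and s1: "complex_of_real (power_sum 1 \<Delta>) = power_sum 1 (complex_of_real \<rho> # ls)"
    and s2: "power_sum 2 \<Delta> \<le> Re (power_sum 2 (complex_of_real \<rho> # ls))"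
  obtains b where "nonneg_mat (companion_form \<Delta> b)"
    and "spectrum_mset (map_mat complex_of_real (companion_form \<Delta> b)) = mset (complex_of_real \<rho> # ls)"
proof -
  have s1': "complex_of_real (\<Sum>d\<leftarrow>\<Delta>. d) = of_real \<rho> + (\<Sum>z\<leftarrow>ls. z)"
    using s1 by (simp add: power_sum_def)
  have s2': "(\<Sum>d\<leftarrow>\<Delta>. d\<^sup>2) \<le> \<rho>\<^sup>2 + Re (\<Sum>z\<leftarrow>ls. z\<^sup>2)"
    using s2 by (simp add: power_sum_def power2_eq_square)
  obtain g where g: "map_poly complex_of_real g = (\<Prod>z\<leftarrow>ls. [:- z, 1:])"
    using real_stable_poly_of_roots[OF ls] by blast
  define f where "f = [:- \<rho>, 1:] * g"
  have f: "map_poly complex_of_real f = (\<Prod>z\<leftarrow>complex_of_real \<rho> # ls. [:- z, 1:])"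
    unfolding f_def map_poly_of_real_mult g by (simp add: map_poly_pCons)
  note low = reversed_fps_of_roots_low_coeffs[OF f]
  have degf: "degree f = length \<Delta>"
  proof -
    have "degree f = degree (map_poly complex_of_real f)"
      by (simp add: degree_map_poly)
    also have "\<dots> = length \<Delta>"
      unfolding f using degree_linear_factors[of uminus "complex_of_real \<rho> # ls"] len by simp
    finally show ?thesis .
  qed
  have lead: "lead_coeff f = 1"
    using low(1) by simp
  have ne: "\<Delta> \<noteq> []"
    using len by auto
  define b where "b k = - divided_difference f (take (length \<Delta> + 1 - k) \<Delta>)" for k
  have b: "0 \<le> b k" if "k \<in> {2..length \<Delta>}" for k
  proof -
    have "1 \<le> length \<Delta> + 1 - k" "length \<Delta> + 1 - k < length \<Delta>"
      using that by auto
    from divided_difference_nonpos[OF \<Delta> ls len f s1' s2' this] show ?thesis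
      by (simp add: b_def)
  qed
  have "divided_difference f \<Delta> = 0"
  proof -
    define W where "W = (\<Prod>d\<leftarrow>\<Delta>. geometric_fps d)"
    have W: "fps_nth W 0 = 1" "fps_nth W 1 = (\<Sum>d\<leftarrow>\<Delta>. d)"
      unfolding W_def by (subst prod_list_fps_low_coeffs; simp add: geometric_fps_eq)+
    have "divided_difference f \<Delta> = fps_nth (reversed_fps f * W) 1"
      using divided_difference_eq_coeff[OF ne, of f] degf by (simp add: W_def)
    also have "\<dots> = fps_nth (reversed_fps f) 1 + (\<Sum>d\<leftarrow>\<Delta>. d)"
      unfolding fps_mult_nth_1 W low(1) by simp
    also have "complex_of_real \<dots> = 0"
      unfolding of_real_add low(2) s1' by simp
    finally show ?thesis
      by simp
  qed
  then have char: "char_poly (companion_form \<Delta> b) = f"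
    by (intro companion_form_realizes ne lead degf) (simp_all add: b_def)
  have "nonneg_mat (companion_form \<Delta> b)"
    unfolding nonneg_mat_def companion_form_def Let_def using \<Delta>(2) b
    by (auto simp: Suc_diff_le)
  moreover have "spectrum_mset (map_mat complex_of_real (companion_form \<Delta> b)) = mset (complex_of_real \<rho> # ls)"
    unfolding spectrum_mset_def of_real_hom.char_poly_hom[OF companion_form_carrier] char f
    by (rule proots_linear_factors)
  ultimately show thesis
    by (rule that)
qed

section \<open>The characterization\<close>

lemma diag_mat_companion_form: "diag_mat (companion_form \<Delta> b) = \<Delta>"
  by (rule nth_equalityI) (simp_all add: diag_mat_def companion_form_def Let_def)

theorem theorem2p1:
  fixes n :: nat
    and \<Delta> :: "real list"
    and \<rho> :: real
    and ls \<sigma> :: "complex list"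
  assumes "n \<ge> 2"
    and "length \<Delta> = n"
    and "sorted_wrt (\<ge>) \<Delta>"
    and "\<forall>a\<in>set \<Delta>. a \<ge> 0"
    and "\<rho> \<ge> 0"
    and "length ls = n - 1"
    and "self_conjugate ls"
    and "\<forall>z\<in>set ls. Re z \<le> 0"
    and "\<sigma> = complex_of_real \<rho> # ls"
  shows "((\<exists>A \<in> carrier_mat n n.
             nonneg_mat A \<and>
             mset (diag_mat A) = mset \<Delta> \<and>
             spectrum_mset (map_mat complex_of_real A) = mset \<sigma>)
          \<longleftrightarrow>
          (complex_of_real (power_sum 1 \<Delta>) = power_sum 1 \<sigma> \<and>
           power_sum 2 \<Delta> \<le> Re (power_sum 2 \<sigma>)))
       \<and> (complex_of_real (power_sum 1 \<Delta>) = power_sum 1 \<sigma> \<and>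
          power_sum 2 \<Delta> \<le> Re (power_sum 2 \<sigma>)
          \<longrightarrow>
          (\<exists>b :: nat \<Rightarrow> real.
             nonneg_mat (companion_form \<Delta> b) \<and>
             spectrum_mset (map_mat complex_of_real (companion_form \<Delta> b)) = mset \<sigma>))"
    (is "(?realizable \<longleftrightarrow> ?conditions) \<and> (?conditions \<longrightarrow> ?companion)")
proof -
  have necessary: ?conditions if realizable: ?realizable
  proof -
    obtain A where "A \<in> carrier_mat n n" "nonneg_mat A" "mset (diag_mat A) = mset \<Delta>"
      "spectrum_mset (map_mat complex_of_real A) = mset \<sigma>"
      using realizable by blast
    from nonneg_realization_imp_power_sums[OF this] show ?thesis
      by (rule conjI)
  qed
  have sufficient: ?companion if conditions: ?conditions
  proof -
    have len: "length \<Delta> = length ls + 1"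
      using assms(1,2,6) by simp
    note conditions = conditions[unfolded assms(9)]
    obtain b where "nonneg_mat (companion_form \<Delta> b)"
      "spectrum_mset (map_mat complex_of_real (companion_form \<Delta> b)) = mset \<sigma>"
      unfolding assms(9)
      by (rule companion_form_realization[OF assms(3,4,7,8) len
            conjunct1[OF conditions] conjunct2[OF conditions]])
    then show ?thesis
      by blast
  qed
  have diagonal: ?realizable if companion: ?companion
  proof -
    obtain b where b: "nonneg_mat (companion_form \<Delta> b)"
      "spectrum_mset (map_mat complex_of_real (companion_form \<Delta> b)) = mset \<sigma>"
      using companion by blast
    show ?thesis
    proof (intro bexI conjI)
      show "companion_form \<Delta> b \<in> carrier_mat n n"
        using companion_form_carrier[of \<Delta> b] assms(2) by simp
    qed (simp_all only: b diag_mat_companion_form)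
  qed
  show ?thesis
  proof (rule conjI[OF iffI impI])
    show ?conditions if ?realizable
      using that by (rule necessary)
    show ?realizable if ?conditions
      using that by (rule diagonal[OF sufficient])
    show ?companion if ?conditions
      using that by (rule sufficient)
  qed
qed

end
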